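(* There exists an absolute constant $C>0$ such that the following holds for every sufficiently large $n$ and every integer $N$ with \[ C n^2 \le N \le \exp\!\left(\frac{n}{C}\right). \] There exists a convex body $K \subseteq \mathbb{R}^n$ such that for every vector $\xi\in\mathbb{R}^n$ lying on the line segment connecting the barycenter of $K$ and the Santaló point of $K$, every polytope $P\subseteq\mathbb{R}^n$ satisfying \[ P \subseteq K-\xi \subseteq \frac{n}{C\log N}\,P \] has at least $N$ vertices.
   Context: A convex body is a compact convex set with nonempty interior. The barycenter of $K$ is its centroid $\frac{1}{|K|}\int_K x\,dx$. For a convex body $L$ containing the origin in its interior, its polar is $L^\circ=\{y:\langle y,z\rangle\le 1 \text{ for all } z\in L\}$. The Santaló point of a convex body $K$ is the unique point $x$ in the interior of $K$ at which $|K-x|\cdot|(K-x)^\circ|$ attains its minimum, where $|\cdot|$ denotes volume. *)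

theory Defs
  imports "HOL-Analysis.Analysis" "HOL-Probability.Probability"
begin

text \<open>The dimension n varies inside the statement ("for every sufficiently large n"),
so R^n is modelled as the functions nat => real vanishing at all indices >= n,
with the Euclidean structure written out explicitly.\<close>

definition Rn :: "nat \<Rightarrow> (nat \<Rightarrow> real) set" where
  "Rn n = {x. \<forall>i\<ge>n. x i = 0}"

definition ipn :: "nat \<Rightarrow> (nat \<Rightarrow> real) \<Rightarrow> (nat \<Rightarrow> real) \<Rightarrow> real" where
  "ipn n x y = (\<Sum>i<n. x i * y i)"

definition distn :: "nat \<Rightarrow> (nat \<Rightarrow> real) \<Rightarrow> (nat \<Rightarrow> real) \<Rightarrow> real" where
  "distn n x y = sqrt (\<Sum>i<n. (x i - y i)^2)"

definition interiorn :: "nat \<Rightarrow> (nat \<Rightarrow> real) set \<Rightarrow> (nat \<Rightarrow> real) set" where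
  "interiorn n K = {x \<in> K. \<exists>e>0. \<forall>y\<in>Rn n. distn n x y < e \<longrightarrow> y \<in> K}"

definition closedn :: "nat \<Rightarrow> (nat \<Rightarrow> real) set \<Rightarrow> bool" where
  "closedn n K \<longleftrightarrow> (\<forall>x\<in>Rn n - K. \<exists>e>0. \<forall>y\<in>Rn n. distn n x y < e \<longrightarrow> y \<notin> K)"

definition boundedn :: "nat \<Rightarrow> (nat \<Rightarrow> real) set \<Rightarrow> bool" where
  "boundedn n K \<longleftrightarrow> (\<exists>B. \<forall>x\<in>K. distn n x (\<lambda>_. 0) \<le> B)"

definition convexn :: "(nat \<Rightarrow> real) set \<Rightarrow> bool" where
  "convexn K \<longleftrightarrow> (\<forall>x\<in>K. \<forall>y\<in>K. \<forall>t::real. 0 \<le> t \<and> t \<le> 1 \<longrightarrow> (\<lambda>i. (1 - t) * x i + t * y i) \<in> K)"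

definition convex_body :: "nat \<Rightarrow> (nat \<Rightarrow> real) set \<Rightarrow> bool" where
  "convex_body n K \<longleftrightarrow> K \<subseteq> Rn n \<and> convexn K \<and> closedn n K \<and> boundedn n K \<and> interiorn n K \<noteq> {}"

definition lebn :: "nat \<Rightarrow> (nat \<Rightarrow> real) measure" where
  "lebn n = (\<Pi>\<^sub>M i\<in>{..<n}. lborel)"

definition voln :: "nat \<Rightarrow> (nat \<Rightarrow> real) set \<Rightarrow> real" where
  "voln n K = measure (lebn n) ((\<lambda>x. restrict x {..<n}) ` K)"

definition barycenter :: "nat \<Rightarrow> (nat \<Rightarrow> real) set \<Rightarrow> (nat \<Rightarrow> real)" where
  "barycenter n K = (\<lambda>i. if i < n then
      (1 / voln n K) * (LINT x : ((\<lambda>x. restrict x {..<n}) ` K) | lebn n. x i) else 0)"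

definition translate :: "(nat \<Rightarrow> real) set \<Rightarrow> (nat \<Rightarrow> real) \<Rightarrow> (nat \<Rightarrow> real) set" where
  "translate K x = (\<lambda>z. (\<lambda>i. z i - x i)) ` K"

definition polarn :: "nat \<Rightarrow> (nat \<Rightarrow> real) set \<Rightarrow> (nat \<Rightarrow> real) set" where
  "polarn n L = {y \<in> Rn n. \<forall>z\<in>L. ipn n y z \<le> 1}"

definition santalo_point :: "nat \<Rightarrow> (nat \<Rightarrow> real) set \<Rightarrow> (nat \<Rightarrow> real)" where
  "santalo_point n K = (THE x. x \<in> interiorn n K \<and>
     (\<forall>y\<in>interiorn n K. voln n (translate K x) * voln n (polarn n (translate K x))
                         \<le> voln n (translate K y) * voln n (polarn n (translate K y))))"

definition segmentn :: "(nat \<Rightarrow> real) \<Rightarrow> (nat \<Rightarrow> real) \<Rightarrow> (nat \<Rightarrow> real) set" where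
  "segmentn a b = {(\<lambda>i. (1 - t) * a i + t * b i) | t::real. 0 \<le> t \<and> t \<le> 1}"

definition scalen :: "real \<Rightarrow> (nat \<Rightarrow> real) set \<Rightarrow> (nat \<Rightarrow> real) set" where
  "scalen r P = (\<lambda>p. (\<lambda>i. r * p i)) ` P"

definition convex_hulln :: "(nat \<Rightarrow> real) set \<Rightarrow> (nat \<Rightarrow> real) set" where
  "convex_hulln V = {x. \<exists>c. (\<forall>v\<in>V. 0 \<le> c v) \<and> sum c V = 1 \<and> x = (\<lambda>i. \<Sum>v\<in>V. c v * v i)}"

definition polytopen :: "nat \<Rightarrow> (nat \<Rightarrow> real) set \<Rightarrow> bool" where
  "polytopen n P \<longleftrightarrow> (\<exists>V. finite V \<and> V \<noteq> {} \<and> V \<subseteq> Rn n \<and> P = convex_hulln V)"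

definition verticesn :: "(nat \<Rightarrow> real) set \<Rightarrow> (nat \<Rightarrow> real) set" where
  "verticesn P = {x \<in> P. \<forall>y\<in>P. \<forall>z\<in>P. \<forall>t::real. 0 < t \<and> t < 1 \<and>
       x = (\<lambda>i. (1 - t) * y i + t * z i) \<longrightarrow> y = z}"

end

theory Submission
  imports Defs
begin

text \<open>Let \<open>K\<close> be the join of the origin with \<open>q\<close> cubes of dimension at least \<open>d\<close>, where \<open>d\<close> is of order
  \<open>ln N\<close> and \<open>q\<close> of order \<open>n / ln N\<close>. Let \<open>P \<subseteq> K - \<xi> \<subseteq> R P\<close> with an arbitrary \<open>\<xi>\<close> and \<open>1 < R \<le> q\<close>. The
  inclusions force the total mass that \<open>\<xi>\<close> gives to the cubes to be at most 1, so some cube gets mass at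
  most \<open>1 / q\<close>. For a sign vector \<open>u\<close> consider the functional \<open>\<langle>u, y\<rangle> - d t / 2\<close>, where \<open>t\<close> is the mass and
  \<open>y\<close> the mass times the position of a point in that cube. At the cube vertex \<open>u\<close> it equals \<open>d / 2\<close>, and
  for at least half of the \<open>u\<close> it is at least \<open>- d / (2 q)\<close> at \<open>\<xi>\<close>; hence some vertex of \<open>P + \<xi>\<close> makes
  it positive. By a Chernoff bound a single point of \<open>K\<close> makes it positive for at most
  \<open>2 ^ d * exp (- d / 16)\<close> sign vectors, so \<open>P\<close> has at least \<open>exp (d / 16) / 2\<close> vertices.\<close>

section \<open>Vertices of polytopes\<close>

lemma convex_hulln_mem:
  assumes "finite V" "v \<in> V"
  shows "v \<in> convex_hulln V"
proof -
  let ?c = "\<lambda>w. if w = v then 1 else (0::real)"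
  have "v = (\<lambda>i. \<Sum>w\<in>V. ?c w * w i)"
    using assms by (intro ext) (simp add: mult_delta_left)
  moreover have "sum ?c V = 1"
    using assms by simp
  ultimately show ?thesis
    unfolding convex_hulln_def by (intro CollectI exI[of _ ?c]) auto
qed

lemma convex_hulln_convex:
  assumes "x \<in> convex_hulln V" "y \<in> convex_hulln V" "0 \<le> t" "t \<le> 1"
  shows "(\<lambda>i. (1 - t) * x i + t * y i) \<in> convex_hulln V"
proof -
  obtain a where a: "\<forall>v\<in>V. 0 \<le> a v" "sum a V = 1" "x = (\<lambda>i. \<Sum>v\<in>V. a v * v i)"
    using assms(1) unfolding convex_hulln_def by auto
  obtain b where b: "\<forall>v\<in>V. 0 \<le> b v" "sum b V = 1" "y = (\<lambda>i. \<Sum>v\<in>V. b v * v i)"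
    using assms(2) unfolding convex_hulln_def by auto
  let ?c = "\<lambda>v. (1 - t) * a v + t * b v"
  have "sum ?c V = 1"
    using a(2) b(2) by (simp add: sum.distrib flip: sum_distrib_left)
  moreover have "(\<lambda>i. (1 - t) * x i + t * y i) = (\<lambda>i. \<Sum>v\<in>V. ?c v * v i)"
    by (simp add: a(3) b(3) sum_distrib_left algebra_simps flip: sum.distrib)
  moreover have "\<forall>v\<in>V. 0 \<le> ?c v"
    using a(1) b(1) assms(3,4) by simp
  ultimately show ?thesis
    unfolding convex_hulln_def by (intro CollectI exI[of _ ?c] conjI)
qed

lemma convex_hulln_mono:
  assumes "finite V" "W \<subseteq> V"
  shows "convex_hulln W \<subseteq> convex_hulln V"
proof
  fix x assume "x \<in> convex_hulln W"
  then obtain a where a: "\<forall>v\<in>W. 0 \<le> a v" "sum a W = 1" "x = (\<lambda>i. \<Sum>v\<in>W. a v * v i)"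
    unfolding convex_hulln_def by auto
  let ?c = "\<lambda>v. if v \<in> W then a v else 0"
  have "sum ?c V = 1"
    using a(2) assms by (simp add: sum.If_cases Int_absorb1)
  moreover have "x = (\<lambda>i. \<Sum>v\<in>V. ?c v * v i)"
    using assms by (simp add: a(3) mult_delta_left sum.If_cases Int_absorb1)
  ultimately show "x \<in> convex_hulln V"
    unfolding convex_hulln_def using a(1) by (intro CollectI exI[of _ ?c]) auto
qed

text \<open>Dividing the remaining weights by \<open>1 - c w\<close> makes them sum to 1. Peeling
  off one point in this way lets extremality be applied to explicit weights.\<close>

lemma convex_hulln_split:
  assumes "finite V" "w \<in> V" "\<forall>v\<in>V. 0 \<le> c v" "sum c V = 1" "c w < (1::real)"
  obtains y where "y \<in> convex_hulln (V - {w})"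
    "(\<lambda>i. \<Sum>v\<in>V. c v * v i) = (\<lambda>i. (1 - c w) * y i + c w * w i)"
proof
  let ?y = "\<lambda>i. \<Sum>v\<in>V - {w}. (c v / (1 - c w)) * v i"
  have "sum c (V - {w}) = 1 - c w"
    using assms by (simp add: sum_diff1)
  then have "(\<Sum>v\<in>V - {w}. c v / (1 - c w)) = 1"
    using assms(5) by (simp flip: sum_divide_distrib)
  then show "?y \<in> convex_hulln (V - {w})"
    unfolding convex_hulln_def using assms(3,5) by (intro CollectI exI[of _ "\<lambda>v. c v / (1 - c w)"]) auto
  show "(\<lambda>i. \<Sum>v\<in>V. c v * v i) = (\<lambda>i. (1 - c w) * ?y i + c w * w i)"
  proof
    fix i
    have "(1 - c w) * ?y i = (\<Sum>v\<in>V - {w}. c v * v i)"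
      using assms(5) by (simp add: sum_distrib_left)
    then show "(\<Sum>v\<in>V. c v * v i) = (1 - c w) * ?y i + c w * w i"
      using assms(1,2) by (simp add: sum.remove)
  qed
qed

lemma coeff_eq_1_unique:
  assumes "finite V" "w \<in> V" "\<forall>v\<in>V. 0 \<le> c v" "sum c V = 1" "c w = (1::real)"
  shows "(\<lambda>i. \<Sum>v\<in>V. c v * v i) = w"
proof -
  have "sum c (V - {w}) = 0"
    using assms by (simp add: sum_diff1)
  then have "\<forall>v\<in>V - {w}. c v = 0"
    using assms by (subst (asm) sum_nonneg_eq_0_iff) auto
  then have "(\<Sum>v\<in>V - {w}. c v * v i) = 0" for i
    by simp
  then show ?thesis
    using assms by (simp add: sum.remove)
qed

lemma coeff_le_1:
  assumes "finite V" "w \<in> V" "\<forall>v\<in>V. 0 \<le> c v" "sum c V = (1::real)"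
  shows "c w \<le> 1"
  using member_le_sum[of w V c] assms by auto

lemma coeff_pos_exists:
  assumes "\<forall>v\<in>V. 0 \<le> c v" "sum c V = (1::real)"
  obtains v where "v \<in> V" "0 < c v"
proof -
  have "\<not> sum c V \<le> 0"
    using assms(2) by simp
  then have "\<exists>v\<in>V. 0 < c v"
    using sum_nonpos[of V c] by (auto simp: not_le[symmetric])
  then show thesis
    using that by blast
qed

text \<open>Some \<open>v\<close> in \<open>V\<close> has positive weight in \<open>x\<close>. If
  this weight is below 1, then \<open>x\<close> divides a segment from \<open>v\<close> to another
  hull point \<open>y\<close>, and extremality forces \<open>y = v\<close>, hence
  \<open>x = v\<close>.\<close>

lemma verticesn_subset:
  assumes "finite V"
  shows "verticesn (convex_hulln V) \<subseteq> V"
proof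
  fix x assume x: "x \<in> verticesn (convex_hulln V)"
  then obtain c where c: "\<forall>v\<in>V. 0 \<le> c v" "sum c V = (1::real)" "x = (\<lambda>i. \<Sum>v\<in>V. c v * v i)"
    unfolding verticesn_def convex_hulln_def by auto
  obtain v where v: "v \<in> V" "c v > 0"
    by (rule coeff_pos_exists[OF c(1,2)])
  show "x \<in> V"
  proof (cases "c v = 1")
    case True
    then show ?thesis
      using coeff_eq_1_unique[OF assms v(1) c(1,2)] c(3) v(1) by simp
  next
    case False
    then have lt: "c v < 1"
      using coeff_le_1[OF assms v(1) c(1,2)] by simp
    obtain y where y: "y \<in> convex_hulln (V - {v})"
      "(\<lambda>i. \<Sum>u\<in>V. c u * u i) = (\<lambda>i. (1 - c v) * y i + c v * v i)"
      by (rule convex_hulln_split[OF assms v(1) c(1,2) lt])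
    note y = y(1) y(2)[folded c(3)]
    have "y \<in> convex_hulln V" "v \<in> convex_hulln V"
      using y(1) convex_hulln_mono[OF assms, of "V - {v}"] convex_hulln_mem[OF assms v(1)] by auto
    moreover have "\<forall>y\<in>convex_hulln V. \<forall>z\<in>convex_hulln V. \<forall>t. 0 < t \<and> t < 1 \<and>
        x = (\<lambda>i. (1 - t) * y i + t * z i) \<longrightarrow> y = z"
      using x unfolding verticesn_def by simp
    ultimately have "y = v"
      using y(2) v(2) lt by auto
    then have "x = v"
      unfolding y(2) by (simp add: algebra_simps)
    then show ?thesis
      using v(1) by simp
  qed
qed

text \<open>Minkowski's theorem for finitely many points. A subset \<open>W\<close> of least
  cardinality with the same hull is irredundant, and this makes each of its points extreme.\<close>

lemma convex_hulln_verticesn: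
  assumes "finite V"
  shows "convex_hulln (verticesn (convex_hulln V)) = convex_hulln V"
proof -
  let ?Q = "\<lambda>W. W \<subseteq> V \<and> convex_hulln W = convex_hulln V"
  obtain W where W: "?Q W" and min: "\<And>W'. ?Q W' \<Longrightarrow> card W \<le> card W'"
    using ex_has_least_nat[of ?Q V card] by auto
  have fin: "finite W"
    using W assms finite_subset by blast
  have "W \<subseteq> verticesn (convex_hulln V)"
  proof
    fix w assume w: "w \<in> W"
    \<comment> \<open>Otherwise \<open>w\<close> could be dropped without changing the hull, against
      minimality.\<close>
    have irr: "w \<notin> convex_hulln (W - {w})"
    proof
      assume w': "w \<in> convex_hulln (W - {w})"
      have "convex_hulln W \<subseteq> convex_hulln (W - {w})"
      proof
        fix x assume "x \<in> convex_hulln W"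
        then obtain c where c: "\<forall>v\<in>W. 0 \<le> c v" "sum c W = (1::real)" "x = (\<lambda>i. \<Sum>v\<in>W. c v * v i)"
          unfolding convex_hulln_def by auto
        show "x \<in> convex_hulln (W - {w})"
        proof (cases "c w = 1")
          case True
          then show ?thesis
            using coeff_eq_1_unique[OF fin w c(1,2)] c(3) w' by simp
        next
          case False
          then have lt: "c w < 1"
            using coeff_le_1[OF fin w c(1,2)] by simp
          obtain y where y: "y \<in> convex_hulln (W - {w})"
            "(\<lambda>i. \<Sum>v\<in>W. c v * v i) = (\<lambda>i. (1 - c w) * y i + c w * w i)"
            by (rule convex_hulln_split[OF fin w c(1,2) lt])
          show ?thesis
            unfolding c(3) y(2) using c(1) w lt by (intro convex_hulln_convex[OF y(1) w']) auto
        qed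
      qed
      then have "?Q (W - {w})"
        using W convex_hulln_mono[OF fin, of "W - {w}"] by auto
      then have "card W \<le> card (W - {w})"
        by (rule min)
      moreover have "card (W - {w}) < card W"
        using w fin by (intro psubset_card_mono) auto
      ultimately show False
        by simp
    qed
    have "y = z" if yz: "y \<in> convex_hulln W" "z \<in> convex_hulln W" and t: "0 < t" "t < 1"
      and eq: "w = (\<lambda>i. (1 - t) * y i + t * z i)" for y z t
    proof -
      obtain a where a: "\<forall>v\<in>W. 0 \<le> a v" "sum a W = (1::real)" "y = (\<lambda>i. \<Sum>v\<in>W. a v * v i)"
        using yz(1) unfolding convex_hulln_def by auto
      obtain b where b: "\<forall>v\<in>W. 0 \<le> b v" "sum b W = (1::real)" "z = (\<lambda>i. \<Sum>v\<in>W. b v * v i)"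
        using yz(2) unfolding convex_hulln_def by auto
      define c where "c v = (1 - t) * a v + t * b v" for v
      have c: "\<forall>v\<in>W. 0 \<le> c v" "sum c W = 1"
        using a b t by (simp_all add: c_def sum.distrib flip: sum_distrib_left)
      have weq: "w = (\<lambda>i. \<Sum>v\<in>W. c v * v i)"
        by (subst eq, unfold a(3) b(3) c_def)
          (simp add: sum_distrib_left algebra_simps flip: sum.distrib)
      \<comment> \<open>If \<open>c w < 1\<close>, then \<open>w = (1 - c w) * x + c w * w\<close>
        can be solved to \<open>w = x\<close>, which lies in the hull of the other points.\<close>
      have "c w = 1"
      proof (rule ccontr)
        assume "c w \<noteq> 1"
        then have lt: "c w < 1"
          using coeff_le_1[OF fin w c] by simp
        obtain x where x: "x \<in> convex_hulln (W - {w})"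
          "(\<lambda>i. \<Sum>v\<in>W. c v * v i) = (\<lambda>i. (1 - c w) * x i + c w * w i)"
          by (rule convex_hulln_split[OF fin w c lt])
        have "w i = x i" for i
        proof -
          have "w i = (1 - c w) * x i + c w * w i"
            using fun_cong[OF weq, of i] fun_cong[OF x(2), of i] by simp
          then have "(1 - c w) * (w i - x i) = 0"
            by (simp add: algebra_simps)
          then show ?thesis
            using lt by simp
        qed
        then have "w = x"
          by (rule ext)
        then show False
          using x(1) irr by simp
      qed
      \<comment> \<open>Now 1 is a mean of \<open>a w\<close> and \<open>b w\<close> with positive
        weights, and neither exceeds 1. So both equal 1, and \<open>y\<close> and \<open>z\<close>
        both coincide with \<open>w\<close>.\<close>
      moreover have "a w \<le> 1" "b w \<le> 1"
        using coeff_le_1[OF fin w] a b by auto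
      moreover from calculation have "(1 - t) * a w \<le> 1 - t" "t * b w \<le> t"
        using t by (auto intro: mult_left_le)
      ultimately have "(1 - t) * a w = 1 - t" "t * b w = t"
        unfolding c_def by linarith+
      then have "a w = 1" "b w = 1"
        using t by simp_all
      then show "y = z"
        using coeff_eq_1_unique[OF fin w a(1,2)] coeff_eq_1_unique[OF fin w b(1,2)] a(3) b(3) by simp
    qed
    then show "w \<in> verticesn (convex_hulln V)"
      unfolding verticesn_def using convex_hulln_mem[OF fin w] W by auto
  qed
  then have "convex_hulln V \<subseteq> convex_hulln (verticesn (convex_hulln V))"
    using convex_hulln_mono[of "verticesn (convex_hulln V)" W] W
      finite_subset[OF verticesn_subset[OF assms] assms] by auto
  then show ?thesis
    using convex_hulln_mono[OF assms verticesn_subset[OF assms]] by auto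
qed

text \<open>The value at \<open>p\<close> is a weighted mean of the values at the vertices, so these
  cannot all be smaller.\<close>

lemma linear_le_at_vertex:
  assumes P: "polytopen n P" and p: "p \<in> P"
  obtains v where "v \<in> verticesn P" "ipn n g p \<le> ipn n g v"
proof -
  obtain V where V: "finite V" "P = convex_hulln V"
    using P unfolding polytopen_def by auto
  let ?W = "verticesn P"
  have "p \<in> convex_hulln ?W"
    using p convex_hulln_verticesn[OF V(1)] V(2) by simp
  then obtain c where c: "\<forall>v\<in>?W. 0 \<le> c v" "sum c ?W = (1::real)" "p = (\<lambda>i. \<Sum>v\<in>?W. c v * v i)"
    unfolding convex_hulln_def by blast
  have lin: "ipn n g p = (\<Sum>v\<in>?W. c v * ipn n g v)"
    unfolding ipn_def c(3) by (simp add: sum_distrib_left) (subst sum.swap, simp add: algebra_simps)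
  have "\<exists>v\<in>?W. ipn n g p \<le> ipn n g v"
  proof (rule ccontr)
    assume neg: "\<not> ?thesis"
    have fin: "finite ?W"
      using verticesn_subset[OF V(1)] V finite_subset by auto
    obtain u where "u \<in> ?W" "c u > 0"
      by (rule coeff_pos_exists[OF c(1,2)])
    then have "c u * ipn n g u < c u * ipn n g p"
      using neg by (simp add: not_le)
    then have "(\<Sum>v\<in>?W. c v * ipn n g v) < (\<Sum>v\<in>?W. c v * ipn n g p)"
      using c(1) neg fin \<open>u \<in> ?W\<close> by (intro sum_strict_mono_ex1) (auto intro!: mult_left_mono)
    then show False
      using lin c(2) by (simp flip: sum_distrib_right)
  qed
  then show thesis
    using that by auto
qed

section \<open>Sign vectors\<close>

text \<open>Indexing sign vectors by subsets turns counting them into counting in a power set, and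
  sums over them into the expansion of a product of two-term sums.\<close>

definition sign_of :: "nat set \<Rightarrow> nat \<Rightarrow> real" where
  "sign_of S l = (if l \<in> S then 1 else -1)"

lemma exp_le_quadratic:
  fixes x :: real
  assumes "\<bar>x\<bar> \<le> 1"
  shows "exp x \<le> 1 + x + x\<^sup>2"
proof (cases "0 \<le> x")
  case True
  then show ?thesis
    using exp_bound[of x] assms by simp
next
  case False
  \<comment> \<open>The product is 1 minus the cube of \<open>x\<close>, and \<open>x\<close> is
    negative here.\<close>
  have "1 \<le> (1 + x + x\<^sup>2) * (1 - x)"
    using False by (simp add: algebra_simps power2_eq_square mult_nonpos_nonneg)
  also have "\<dots> \<le> (1 + x + x\<^sup>2) * exp (- x)"
    using exp_ge_add_one_self[of "- x"] assms
    by (intro mult_left_mono) (auto simp: abs_if split: if_splits)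
  finally show ?thesis
    by (simp add: exp_minus field_simps)
qed

text \<open>This is \<open>2 ^ d\<close> times the moment generating function of a random signed
  sum. It factors over the coordinates, and in each factor \<open>exp (a l) + exp (- a l)\<close>
  the linear terms cancel.\<close>

lemma sum_exp_sign_of_le:
  fixes a :: "nat \<Rightarrow> real" and \<epsilon> :: real
  assumes "\<And>l. l < d \<Longrightarrow> \<bar>a l\<bar> \<le> \<epsilon>" "\<epsilon> \<le> 1"
  shows "(\<Sum>S\<in>Pow {..<d}. exp (\<Sum>l<d. sign_of S l * a l)) \<le> 2 ^ d * exp (real d * \<epsilon>\<^sup>2)"
proof -
  have "(\<Sum>S\<in>Pow {..<d}. exp (\<Sum>l<d. sign_of S l * a l))
      = (\<Sum>S\<in>Pow {..<d}. (\<Prod>l\<in>S. exp (a l)) * (\<Prod>l\<in>{..<d} - S. exp (- a l)))"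
  proof (rule sum.cong)
    fix S assume S: "S \<in> Pow {..<d}"
    have "exp (\<Sum>l<d. sign_of S l * a l) = (\<Prod>l<d. exp (sign_of S l * a l))"
      by (simp add: exp_sum)
    also have "\<dots> = (\<Prod>l\<in>S. exp (sign_of S l * a l)) * (\<Prod>l\<in>{..<d} - S. exp (sign_of S l * a l))"
      using S by (subst prod.subset_diff[of S]) (auto simp: mult.commute)
    also have "\<dots> = (\<Prod>l\<in>S. exp (a l)) * (\<Prod>l\<in>{..<d} - S. exp (- a l))"
      by (simp add: sign_of_def)
    finally show "exp (\<Sum>l<d. sign_of S l * a l) = \<dots>" .
  qed simp
  also have "\<dots> = (\<Prod>l<d. exp (a l) + exp (- a l))"
    by (simp add: prod_add)
  also have "\<dots> \<le> (\<Prod>l<d. 2 * exp (\<epsilon>\<^sup>2))"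
  proof (rule prod_mono)
    fix l assume l: "l \<in> {..<d}"
    have "exp (a l) + exp (- a l) \<le> 2 * (1 + (a l)\<^sup>2)"
      using exp_le_quadratic[of "a l"] exp_le_quadratic[of "- a l"] assms l by force
    also have "\<dots> \<le> 2 * (1 + \<epsilon>\<^sup>2)"
      using assms(1)[of l] l by (simp add: abs_le_square_iff[symmetric])
    also have "\<dots> \<le> 2 * exp (\<epsilon>\<^sup>2)"
      by (intro mult_left_mono exp_ge_add_one_self) simp
    finally show "0 \<le> exp (a l) + exp (- a l) \<and> exp (a l) + exp (- a l) \<le> 2 * exp (\<epsilon>\<^sup>2)"
      by (simp add: add_nonneg_nonneg)
  qed
  also have "\<dots> = 2 ^ d * exp (real d * \<epsilon>\<^sup>2)"
    by (simp add: power_mult_distrib exp_of_nat_mult)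
  finally show ?thesis .
qed

text \<open>Chernoff bound: after scaling by \<open>1 / (4 * r)\<close> every counted
  \<open>S\<close> contributes at least \<open>exp (d / 8)\<close> to an exponential sum of size at
  most \<open>2 ^ d * exp (d / 16)\<close>.\<close>

lemma card_sign_correlated_le:
  assumes w: "\<And>l. l < d \<Longrightarrow> \<bar>w l\<bar> \<le> r"
  shows "real (card {S \<in> Pow {..<d}. real d / 2 * r < (\<Sum>l<d. sign_of S l * w l)})
    \<le> 2 ^ d * exp (- (real d / 16))" (is "real (card ?A) \<le> _")
proof (cases "0 < r")
  \<comment> \<open>All \<open>w l\<close> vanish and the threshold is nonnegative, so no sign
    vector is counted.\<close>
  case False
  have "w l = 0" if "l < d" for l
    using w[OF that] False by linarith
  then have "(\<Sum>l<d. sign_of S l * w l) = 0" for S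
    by simp
  moreover have "0 \<le> real d / 2 * r"
  proof (cases d)
    case (Suc k)
    then show ?thesis
      using w[of 0] by auto
  qed simp
  ultimately have "?A = {}"
    by auto
  then show ?thesis
    by (metis card.empty of_nat_0 mult_nonneg_nonneg exp_ge_zero zero_le_power zero_le_numeral)
next
  case r: True
  define a where "a l = w l / (4 * r)" for l
  have sum_a: "(\<Sum>l<d. sign_of S l * a l) = (\<Sum>l<d. sign_of S l * w l) / (4 * r)" for S
    by (simp add: a_def sum_divide_distrib)
  have "real (card ?A) * exp (real d / 8) = (\<Sum>S\<in>?A. exp (real d / 8))"
    by simp
  also have "\<dots> \<le> (\<Sum>S\<in>?A. exp (\<Sum>l<d. sign_of S l * a l))"
  proof (rule sum_mono)
    fix S assume "S \<in> ?A"
    then show "exp (real d / 8) \<le> exp (\<Sum>l<d. sign_of S l * a l)"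
      using r unfolding sum_a by (simp add: field_simps)
  qed
  also have "\<dots> \<le> (\<Sum>S\<in>Pow {..<d}. exp (\<Sum>l<d. sign_of S l * a l))"
    by (rule sum_mono2) auto
  also have "\<dots> \<le> 2 ^ d * exp (real d * (1/4)\<^sup>2)"
    using w r by (intro sum_exp_sign_of_le) (auto simp: a_def field_simps)
  also have "\<dots> = 2 ^ d * exp (- (real d / 16)) * exp (real d / 8)"
    by (simp add: mult.assoc power2_eq_square flip: exp_add)
  finally show ?thesis
    by simp
qed

text \<open>Complementing \<open>S\<close> negates the signed sum, so of \<open>S\<close> and its
  complement at least one is counted.\<close>

lemma card_sign_nonneg_ge:
  "2 ^ d \<le> 2 * card {S \<in> Pow {..<d}. 0 \<le> (\<Sum>l<d. sign_of S l * w l)}" (is "_ \<le> 2 * card ?G")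
proof -
  have flip: "(\<Sum>l<d. sign_of ({..<d} - S) l * w l) = - (\<Sum>l<d. sign_of S l * w l)" for S
    by (auto simp: sign_of_def simp flip: sum_negf intro!: sum.cong)
  have "Pow {..<d} \<subseteq> ?G \<union> (\<lambda>S. {..<d} - S) ` ?G"
  proof
    fix S assume S: "S \<in> Pow {..<d}"
    show "S \<in> ?G \<union> (\<lambda>S. {..<d} - S) ` ?G"
    proof (cases "S \<in> ?G")
      case False
      then have "{..<d} - S \<in> ?G"
        using S flip[of S] by auto
      moreover have "S = {..<d} - ({..<d} - S)"
        using S by auto
      ultimately show ?thesis
        by blast
    qed simp
  qed
  then have "card (Pow {..<d}) \<le> card (?G \<union> (\<lambda>S. {..<d} - S) ` ?G)"
    by (intro card_mono) auto
  also have "\<dots> \<le> card ?G + card ((\<lambda>S. {..<d} - S) ` ?G)"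
    by (rule card_Un_le)
  also have "\<dots> \<le> card ?G + card ?G"
    by (intro add_left_mono card_image_le) auto
  finally show ?thesis
    by (simp add: card_Pow)
qed

section \<open>The join of cubes\<close>

text \<open>Coordinate \<open>j < q\<close> is the mass of the \<open>j\<close>-th cube, and the coordinates \<open>i \<ge> q\<close> with
  \<open>i mod q = j\<close> are the mass times the position in that cube.\<close>

definition cube_join :: "nat \<Rightarrow> nat \<Rightarrow> (nat \<Rightarrow> real) set" where
  "cube_join n q = {x \<in> Rn n. (\<forall>i. q \<le> i \<and> i < n \<longrightarrow> \<bar>x i\<bar> \<le> x (i mod q)) \<and>
     (\<forall>j<q. 0 \<le> x j) \<and> (\<Sum>j<q. x j) \<le> 1}"

section \<open>The join of cubes is a convex body\<close>

lemma abs_diff_le_distn: "i < n \<Longrightarrow> \<bar>x i - y i\<bar> \<le> distn n x y"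
  unfolding distn_def using member_le_sum[of i "{..<n}" "\<lambda>i. (x i - y i)\<^sup>2"]
  by (intro real_le_rsqrt) auto

lemma cube_join_abs_le_1:
  assumes "x \<in> cube_join n q" "0 < q"
  shows "\<bar>x i\<bar> \<le> 1"
proof -
  have le1: "x j \<le> 1" if "j < q" for j
    using assms member_le_sum[of j "{..<q}" x] that unfolding cube_join_def by fastforce
  consider "i < q" | "q \<le> i" "i < n" | "n \<le> i"
    by linarith
  then show ?thesis
  proof cases
    case 1
    then show ?thesis
      using le1[of i] assms unfolding cube_join_def by auto
  next
    case 2
    then have "\<bar>x i\<bar> \<le> x (i mod q)"
      using assms unfolding cube_join_def by blast
    then show ?thesis
      using le1[of "i mod q"] assms(2) by simp
  next
    case 3
    then show ?thesis
      using assms unfolding cube_join_def Rn_def by auto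
  qed
qed

lemma convexn_cube_join: "convexn (cube_join n q)"
  unfolding convexn_def
proof (intro ballI allI impI)
  fix x y :: "nat \<Rightarrow> real" and t :: real
  assume x: "x \<in> cube_join n q" and y: "y \<in> cube_join n q" and t: "0 \<le> t \<and> t \<le> 1"
  let ?z = "\<lambda>i. (1 - t) * x i + t * y i"
  have "\<bar>?z i\<bar> \<le> ?z (i mod q)" if "q \<le> i" "i < n" for i
  proof -
    have "\<bar>?z i\<bar> \<le> (1 - t) * \<bar>x i\<bar> + t * \<bar>y i\<bar>"
      using t abs_triangle_ineq[of "(1 - t) * x i" "t * y i"] by (simp add: abs_mult)
    also have "\<dots> \<le> ?z (i mod q)"
      using x y t that unfolding cube_join_def by (intro add_mono mult_left_mono) auto
    finally show ?thesis .
  qed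
  moreover have "(\<Sum>j<q. ?z j) \<le> 1"
  proof -
    have "(\<Sum>j<q. ?z j) = (1 - t) * (\<Sum>j<q. x j) + t * (\<Sum>j<q. y j)"
      by (simp add: sum.distrib sum_distrib_left)
    also have "\<dots> \<le> (1 - t) * 1 + t * 1"
      using x y t unfolding cube_join_def by (intro add_mono mult_left_mono) auto
    finally show ?thesis
      by simp
  qed
  ultimately show "?z \<in> cube_join n q"
    using x y t unfolding cube_join_def Rn_def by auto
qed

lemma closedn_cube_join:
  assumes "0 < q" "q \<le> n"
  shows "closedn n (cube_join n q)"
  unfolding closedn_def
proof
  fix x assume x: "x \<in> Rn n - cube_join n q"
  then consider i where "q \<le> i" "i < n" "\<bar>x i\<bar> > x (i mod q)" | j where "j < q" "x j < 0"
    | "(\<Sum>j<q. x j) > 1"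
    unfolding cube_join_def by force
  then show "\<exists>e>0. \<forall>y\<in>Rn n. distn n x y < e \<longrightarrow> y \<notin> cube_join n q"
  proof cases
    case 1
    have "i mod q < n"
      using assms by (meson mod_less_divisor less_le_trans)
    \<comment> \<open>Both sides can move by the distance, hence half of the gap.\<close>
    then have "\<bar>y i\<bar> > y (i mod q)" if "distn n x y < (\<bar>x i\<bar> - x (i mod q)) / 2" for y
      using that abs_diff_le_distn[OF \<open>i < n\<close>, of x y] abs_diff_le_distn[OF \<open>i mod q < n\<close>, of x y] 1
      by argo
    then show ?thesis
      using 1 unfolding cube_join_def by (intro exI[of _ "(\<bar>x i\<bar> - x (i mod q)) / 2"]) force
  next
    case 2
    then have "y j < 0" if "distn n x y < - x j" for y
      using that abs_diff_le_distn[of j n x y] assms by linarith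
    then show ?thesis
      using 2 unfolding cube_join_def by (intro exI[of _ "- x j"]) force
  next
    case 3
    \<comment> \<open>Each of the \<open>q\<close> masses can move by the distance, hence the
      division by \<open>q\<close>.\<close>
    have "(\<Sum>j<q. y j) > 1" if "distn n x y < ((\<Sum>j<q. x j) - 1) / q" for y
    proof -
      have "(\<Sum>j<q. x j) - (\<Sum>j<q. y j) = (\<Sum>j<q. x j - y j)"
        by (simp add: sum_subtractf)
      also have "\<dots> \<le> (\<Sum>j<q. distn n x y)"
      proof (rule sum_mono)
        fix j assume "j \<in> {..<q}"
        then show "x j - y j \<le> distn n x y"
          using abs_diff_le_distn[of j n x y] assms by simp
      qed
      also have "\<dots> < (\<Sum>j<q. x j) - 1"
        using that assms by (simp add: field_simps)
      finally show ?thesis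
        by simp
    qed
    then show ?thesis
      using 3 assms unfolding cube_join_def
      by (intro exI[of _ "((\<Sum>j<q. x j) - 1) / q"]) force
  qed
qed

lemma boundedn_cube_join:
  assumes "0 < q"
  shows "boundedn n (cube_join n q)"
  unfolding boundedn_def
proof (intro exI ballI)
  fix x assume x: "x \<in> cube_join n q"
  have "(\<Sum>i<n. (x i - 0)\<^sup>2) \<le> (\<Sum>i<n. 1)"
    using cube_join_abs_le_1[OF x assms] by (intro sum_mono) (simp add: abs_square_le_1)
  then show "distn n x (\<lambda>_. 0) \<le> sqrt n"
    unfolding distn_def by simp
qed

lemma interiorn_cube_join:
  assumes "0 < q" "q \<le> n"
  shows "interiorn n (cube_join n q) \<noteq> {}"
proof -
  \<comment> \<open>With masses \<open>2 * e\<close> and all other coordinates 0, a perturbation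
    below \<open>e\<close> leaves each mass above \<open>e\<close>, the other coordinates below
    \<open>e\<close> in absolute value, and the total mass at most \<open>3 / 4\<close>.\<close>
  define x where "x i = (if i < q then 1 / (2 * real q) else 0)" for i
  define e where "e = 1 / (4 * real q)"
  have e: "0 < e" "1 / (2 * real q) = 2 * e"
    using assms by (auto simp: e_def)
  have near: "y \<in> cube_join n q" if y: "y \<in> Rn n" "distn n x y < e" for y
  proof -
    have close: "\<bar>x i - y i\<bar> < e" if "i < n" for i
      using abs_diff_le_distn[OF that, of x y] y(2) by linarith
    have small: "e < y j \<and> y j < 3 * e" if "j < q" for j
      using close[of j] that assms e by (auto simp: x_def)
    have "\<bar>y i\<bar> \<le> y (i mod q)" if "q \<le> i" "i < n" for i
      using close[of i] small[of "i mod q"] that assms by (auto simp: x_def)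
    moreover have "(\<Sum>j<q. y j) \<le> 1"
    proof -
      have "(\<Sum>j<q. y j) \<le> (\<Sum>j<q. 3 * e)"
        using small by (intro sum_mono) (auto intro: less_imp_le)
      also have "\<dots> \<le> 1"
        using assms by (simp add: e_def)
      finally show ?thesis .
    qed
    ultimately show ?thesis
      unfolding cube_join_def using y(1) small e(1) by (force intro: less_imp_le less_trans)
  qed
  have "x \<in> Rn n"
    using assms by (auto simp: Rn_def x_def)
  moreover have "distn n x x < e"
    using e(1) by (simp add: distn_def)
  ultimately have "x \<in> interiorn n (cube_join n q)"
    unfolding interiorn_def using near e(1) by blast
  then show ?thesis
    by blast
qed

lemma convex_body_cube_join:
  assumes "0 < q" "q \<le> n"
  shows "convex_body n (cube_join n q)"
  unfolding convex_body_def
  using convexn_cube_join closedn_cube_join[OF assms] boundedn_cube_join[OF assms(1)]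
    interiorn_cube_join[OF assms]
  by (auto simp: cube_join_def)

section \<open>Counting the vertices of a sandwiched polytope\<close>

lemma ipn_diff: "ipn n g (\<lambda>i. x i - y i) = ipn n g x - ipn n g y"
  by (simp add: ipn_def right_diff_distrib sum_subtractf)

text \<open>Write \<open>z - \<xi>\<close> as \<open>R * p'\<close> with \<open>p'\<close> in
  \<open>P\<close>. A vertex of \<open>P\<close> does at least as well as \<open>p'\<close> in
  direction \<open>g\<close>, and shifting it back by \<open>\<xi>\<close> gives a point of
  \<open>K\<close>.\<close>

lemma sandwich_vertex:
  assumes P: "polytopen n P" and sub: "P \<subseteq> translate K \<xi>" and sup: "translate K \<xi> \<subseteq> scalen R P"
    and R: "0 < R" and z: "z \<in> K"
  obtains p x where "p \<in> verticesn P" "x \<in> K" "p = (\<lambda>i. x i - \<xi> i)"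
    "ipn n g z / R + (1 - 1 / R) * ipn n g \<xi> \<le> ipn n g x"
proof -
  have "(\<lambda>i. z i - \<xi> i) \<in> scalen R P"
    using sup z unfolding translate_def by auto
  then obtain p' where p': "p' \<in> P" "(\<lambda>i. z i - \<xi> i) = (\<lambda>i. R * p' i)"
    unfolding scalen_def by auto
  obtain p where p: "p \<in> verticesn P" "ipn n g p' \<le> ipn n g p"
    using linear_le_at_vertex[OF P p'(1)] .
  obtain x where x: "x \<in> K" "p = (\<lambda>i. x i - \<xi> i)"
    using p(1) sub unfolding verticesn_def translate_def by auto
  have "ipn n g z - ipn n g \<xi> = ipn n g (\<lambda>i. R * p' i)"
    using p'(2) by (metis ipn_diff)
  also have "\<dots> = R * ipn n g p'"
    by (simp add: ipn_def sum_distrib_left algebra_simps)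
  finally have "(ipn n g z - ipn n g \<xi>) / R \<le> ipn n g x - ipn n g \<xi>"
    using p(2) R unfolding x(2) ipn_diff by simp
  then have "ipn n g z / R + (1 - 1 / R) * ipn n g \<xi> \<le> ipn n g x"
    by (simp add: diff_divide_distrib algebra_simps)
  then show thesis
    using that p(1) x by blast
qed

text \<open>The bound \<open>q * (d + 1) \<le> n\<close> leaves at least \<open>d\<close> position
  coordinates for each of the \<open>q\<close> masses; \<open>R \<le> real q\<close> makes the gain
  at a cube vertex outweigh the loss at \<open>\<xi>\<close>.\<close>

lemma cube_join_vertex_count:
  assumes P: "polytopen n P" and sub: "P \<subseteq> translate (cube_join n q) \<xi>"
    and sup: "translate (cube_join n q) \<xi> \<subseteq> scalen R P"
    and R: "1 \<le> R" "R \<le> real q" and q: "q * (d + 1) \<le> n"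
  shows "exp (real d / 16) / 2 \<le> real (card (verticesn P))"
proof -
  let ?K = "cube_join n q"
  have q0: "0 < q"
    using R by (cases q) auto
  have qn: "q \<le> n"
    using q by simp
  \<comment> \<open>The factor \<open>1 - 1 / R\<close> is kept on both sides because it vanishes
    when \<open>R = 1\<close>. The test functional \<open>g\<close> is the total mass, which attains
    its maximum 1 over the body at \<open>z\<close>.\<close>
  have mass: "(1 - 1 / R) * (\<Sum>j<q. \<xi> j) \<le> 1 - 1 / R"
  proof -
    define z where "z i = (if i = 0 then 1 else 0 :: real)" for i :: nat
    define g where "g i = (if i < q then 1 else 0 :: real)" for i
    have g: "ipn n g y = (\<Sum>j<q. y j)" for y
    proof -
      have "ipn n g y = (\<Sum>i<n. if i \<in> {..<q} then y i else 0)"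
        unfolding ipn_def g_def by (intro sum.cong) auto
      also have "\<dots> = (\<Sum>j\<in>{..<n} \<inter> {..<q}. y j)"
        by (simp add: sum.inter_restrict)
      finally show ?thesis
        using qn by (simp add: Int_absorb1)
    qed
    have z: "z \<in> ?K"
      using q0 qn unfolding cube_join_def Rn_def z_def by auto
    obtain p x where x: "x \<in> ?K" "ipn n g z / R + (1 - 1 / R) * ipn n g \<xi> \<le> ipn n g x"
      using sandwich_vertex[OF P sub sup _ z, of g] R by auto
    have "(\<Sum>j<q. z j) = 1" "(\<Sum>j<q. x j) \<le> 1"
      using q0 x(1) by (auto simp: z_def cube_join_def)
    then have "1 / R + (1 - 1 / R) * (\<Sum>j<q. \<xi> j) \<le> 1"
      using x(2) unfolding g by simp
    then show ?thesis
      by simp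
  qed
  have "\<exists>j<q. (1 - 1 / R) * \<xi> j \<le> (1 - 1 / R) / real q"
  proof (rule ccontr)
    assume neg: "\<not> ?thesis"
    have "(\<Sum>j<q. (1 - 1 / R) / real q) < (\<Sum>j<q. (1 - 1 / R) * \<xi> j)"
    proof (rule sum_strict_mono)
      show "(1 - 1 / R) / real q < (1 - 1 / R) * \<xi> j" if "j \<in> {..<q}" for j
        using neg that by (meson lessThan_iff not_le)
    qed (use q0 in auto)
    then show False
      using mass q0 by (simp flip: sum_distrib_left)
  qed
  then obtain j where j: "j < q" "(1 - 1 / R) * \<xi> j \<le> (1 - 1 / R) / real q"
    by blast
  \<comment> \<open>The position coordinates of cube \<open>j\<close>; the shift
    \<open>l + 1\<close> skips the mass coordinate \<open>j\<close> itself.\<close>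
  define \<iota> where "\<iota> l = j + q * (l + 1)" for l
  have \<iota>: "\<iota> l < n" "q \<le> \<iota> l" "\<iota> l mod q = j" if "l < d" for l
  proof -
    have "\<iota> l < q * (l + 2)"
      using j(1) by (simp add: \<iota>_def)
    also have "\<dots> \<le> q * (d + 1)"
      using that by (intro mult_le_mono2) simp
    finally show "\<iota> l < n"
      using q by simp
    show "q \<le> \<iota> l"
      by (simp add: \<iota>_def)
    show "\<iota> l mod q = j"
      unfolding \<iota>_def mod_mult_self2 using j(1) by simp
  qed
  have inj: "inj_on \<iota> {..<d}"
    using q0 by (auto simp: inj_on_def \<iota>_def)
  \<comment> \<open>On the body the signed sum is at most \<open>d * x j\<close>;
    \<open>\<phi> S\<close> is positive where it exceeds half of that maximum.\<close>
  define \<phi> where "\<phi> S x = (\<Sum>l<d. sign_of S l * x (\<iota> l)) - real d / 2 * x j" for S x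
  have \<phi>_linear: "\<exists>g. \<forall>x. \<phi> S x = ipn n g x" for S
  proof -
    define g where "g i = (\<Sum>l<d. if \<iota> l = i then sign_of S l else 0)
      - (if i = j then real d / 2 else 0)" for i
    have "ipn n g x = \<phi> S x" for x
    proof -
      have "ipn n g x = (\<Sum>i<n. \<Sum>l<d. if \<iota> l = i then sign_of S l * x i else 0)
          - (\<Sum>i<n. if i = j then real d / 2 * x i else 0)"
        unfolding ipn_def g_def sum_subtractf[symmetric] sum_distrib_right left_diff_distrib
        by (intro sum.cong arg_cong2[where f = minus]) auto
      also have "(\<Sum>i<n. \<Sum>l<d. if \<iota> l = i then sign_of S l * x i else 0)
          = (\<Sum>l<d. \<Sum>i<n. if \<iota> l = i then sign_of S l * x i else 0)"
        by (rule sum.swap)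
      also have "\<dots> = (\<Sum>l<d. sign_of S l * x (\<iota> l))"
        using \<iota>(1) by (intro sum.cong) auto
      also have "(\<Sum>i<n. if i = j then real d / 2 * x i else 0) = real d / 2 * x j"
        using j(1) qn by simp
      finally show ?thesis
        by (simp add: \<phi>_def)
    qed
    then show ?thesis
      by metis
  qed
  let ?V = "verticesn P"
  let ?G = "{S \<in> Pow {..<d}. 0 \<le> (\<Sum>l<d. sign_of S l * \<xi> (\<iota> l))}"
  let ?H = "\<lambda>p. {S \<in> Pow {..<d}. 0 < \<phi> S (\<lambda>i. p i + \<xi> i)}"
  have finV: "finite ?V"
    using P verticesn_subset finite_subset unfolding polytopen_def by metis
  have verts: "real (card (?H p)) \<le> 2 ^ d * exp (- (real d / 16))" if p: "p \<in> ?V" for p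
  proof -
    define x where "x i = p i + \<xi> i" for i
    have "x \<in> ?K"
      using sub p unfolding verticesn_def translate_def x_def by auto
    then have "\<bar>x (\<iota> l)\<bar> \<le> x j" if "l < d" for l
      using \<iota>[OF that] unfolding cube_join_def by auto
    then show ?thesis
      using card_sign_correlated_le[of d "\<lambda>l. x (\<iota> l)" "x j"] by (simp add: \<phi>_def x_def)
  qed
  have cover: "?G \<subseteq> (\<Union>p\<in>?V. ?H p)" if d: "0 < d"
  proof
    fix S assume S: "S \<in> ?G"
    \<comment> \<open>All mass sits in cube \<open>j\<close>, at the sign vector of
      \<open>S\<close>; any position coordinates beyond the first \<open>d\<close> are 0.\<close>
    define z where "z i = (if i = j then 1 else (\<Sum>l<d. if \<iota> l = i then sign_of S l else 0))" for i
    have z_j: "z j = 1"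
      by (simp add: z_def)
    have z_\<iota>: "z (\<iota> l) = sign_of S l" if "l < d" for l
    proof -
      have "(\<Sum>l'<d. if \<iota> l' = \<iota> l then sign_of S l' else 0)
          = (\<Sum>l'<d. if l' = l then sign_of S l' else 0)"
        using that inj by (intro sum.cong) (auto simp: inj_on_def)
      also have "\<dots> = sign_of S l"
        using that by simp
      finally show ?thesis
        using \<iota>(2)[OF that] j(1) by (simp add: z_def)
    qed
    have z_0: "z i = 0" if "i \<noteq> j" "i \<notin> \<iota> ` {..<d}" for i
      using that by (auto simp: z_def intro!: sum.neutral)
    have z_mass: "z i = (if i = j then 1 else 0)" if "i < q" for i
      using z_j z_0[of i] that \<iota>(2) by force
    have "z \<in> ?K"
    proof -
      have "\<bar>z i\<bar> \<le> z (i mod q)" if "q \<le> i" "i < n" for i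
      proof (cases "i \<in> \<iota> ` {..<d}")
        case True
        then obtain l where "l < d" "i = \<iota> l"
          by auto
        then show ?thesis
          using z_\<iota> z_j \<iota>(3) by (simp add: sign_of_def)
      next
        case False
        then show ?thesis
          using z_0[of i] z_mass[of "i mod q"] that j(1) q0 by auto
      qed
      moreover have "z \<in> Rn n"
        unfolding Rn_def
      proof (intro CollectI allI impI)
        fix i assume "n \<le> i"
        then show "z i = 0"
          using \<iota>(1) j(1) qn by (intro z_0) force+
      qed
      moreover have "(\<Sum>i<q. z i) = 1"
        using z_mass j(1) by simp
      ultimately show ?thesis
        using z_mass unfolding cube_join_def by auto
    qed
    obtain g where g: "\<And>x. \<phi> S x = ipn n g x"
      using \<phi>_linear by blast
    obtain p x where x: "p \<in> ?V" "x \<in> ?K" "p = (\<lambda>i. x i - \<xi> i)"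
      "\<phi> S z / R + (1 - 1 / R) * \<phi> S \<xi> \<le> \<phi> S x"
      using sandwich_vertex[OF P sub sup _ \<open>z \<in> ?K\<close>, of g] R unfolding g by auto
    have "sign_of S l * z (\<iota> l) = 1" if "l < d" for l
      using z_\<iota>[OF that] by (simp add: sign_of_def)
    then have "\<phi> S z = real d / 2"
      by (simp add: \<phi>_def z_j)
    \<comment> \<open>Since \<open>S\<close> is in \<open>?G\<close>, the signed sum at
      \<open>\<xi>\<close> is nonnegative, and only the mass term can make
      \<open>\<phi> S \<xi>\<close> negative.\<close>
    moreover have "- (real d / 2 * ((1 - 1 / R) / real q)) \<le> (1 - 1 / R) * \<phi> S \<xi>"
    proof -
      have "- (real d / 2 * ((1 - 1 / R) / real q)) \<le> - (real d / 2 * ((1 - 1 / R) * \<xi> j))"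
        using mult_left_mono[OF j(2), of "real d / 2"] by simp
      also have "\<dots> = (1 - 1 / R) * (- (real d / 2 * \<xi> j))"
        by simp
      also have "\<dots> \<le> (1 - 1 / R) * \<phi> S \<xi>"
        using S R unfolding \<phi>_def by (intro mult_left_mono) auto
      finally show ?thesis .
    qed
    \<comment> \<open>The strict inequality comes from \<open>1 - 1 / R < 1\<close>, followed by
      \<open>1 / q \<le> 1 / R\<close>.\<close>
    moreover have "0 < real d / 2 / R - real d / 2 * ((1 - 1 / R) / real q)"
    proof -
      have "(1 - 1 / R) / real q < 1 / real q"
        using R q0 by (intro divide_strict_right_mono) auto
      also have "\<dots> \<le> 1 / R"
        using R by (intro divide_left_mono) auto
      finally have "real d / 2 * ((1 - 1 / R) / real q) < real d / 2 * (1 / R)"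
        using d by (intro mult_strict_left_mono) auto
      then show ?thesis
        by simp
    qed
    moreover have "real d / 2 / R + (1 - 1 / R) * \<phi> S \<xi> \<le> \<phi> S x"
      using x(4) calculation(1) by simp
    ultimately have "0 < \<phi> S x"
      by linarith
    then have "S \<in> ?H p"
      using S unfolding x(3) by simp
    then show "S \<in> (\<Union>p\<in>?V. ?H p)"
      using x(1) by blast
  qed
  show ?thesis
  proof (cases "d = 0")
    \<comment> \<open>For \<open>d = 0\<close> the functionals vanish and the covering fails, but
      the claim only asks for one vertex.\<close>
    case True
    obtain p0 where "p0 \<in> P"
      using P convex_hulln_mem unfolding polytopen_def by blast
    then have "?V \<noteq> {}"
      using linear_le_at_vertex[OF P] by blast
    then have "1 \<le> card ?V"
      using finV by (simp add: Suc_le_eq card_gt_0_iff)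
    then show ?thesis
      using True by simp
  next
    case False
    \<comment> \<open>Double counting: half of all sign vectors are covered by the sets
      \<open>?H p\<close>, each of size at most \<open>2 ^ d * exp (- (d / 16))\<close>.\<close>
    have "real (2 ^ d) \<le> real (2 * card ?G)"
      by (rule of_nat_mono) (rule card_sign_nonneg_ge)
    then have "2 ^ d \<le> 2 * real (card ?G)"
      by (simp only: of_nat_power of_nat_mult of_nat_numeral)
    also have "real (card ?G) \<le> real (\<Sum>p\<in>?V. card (?H p))"
    proof (rule of_nat_mono)
      have "card ?G \<le> card (\<Union>p\<in>?V. ?H p)"
        using False finV cover by (intro card_mono) auto
      also have "\<dots> \<le> (\<Sum>p\<in>?V. card (?H p))"
        by (rule card_UN_le[OF finV])
      finally show "card ?G \<le> (\<Sum>p\<in>?V. card (?H p))" .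
    qed
    also have "real (\<Sum>p\<in>?V. card (?H p)) \<le> (\<Sum>p\<in>?V. 2 ^ d * exp (- (real d / 16)))"
      unfolding of_nat_sum using verts by (intro sum_mono) auto
    finally have "(2::real) ^ d \<le> 2 ^ d * (2 * real (card ?V) * exp (- (real d / 16)))"
      by simp
    then have "1 \<le> 2 * real (card ?V) * exp (- (real d / 16))"
      by (simp add: mult_le_cancel_left1)
    then show ?thesis
      by (simp add: exp_minus field_simps)
  qed
qed

section \<open>Choice of the constant and the parameters\<close>

theorem theorem1p1:
  shows "\<exists>C::real. C > 0 \<and> (\<exists>n0::nat. \<forall>n\<ge>n0. \<forall>N::nat.
     C * real n ^ 2 \<le> real N \<and> real N \<le> exp (real n / C) \<longrightarrow>
     (\<exists>K. convex_body n K \<and>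
        (\<forall>\<xi>\<in>segmentn (barycenter n K) (santalo_point n K).
           \<forall>P. polytopen n P \<and> P \<subseteq> translate K \<xi> \<and>
               translate K \<xi> \<subseteq> scalen (real n / (C * ln (real N))) P
               \<longrightarrow> card (verticesn P) \<ge> N)))"
proof (intro exI[of _ "200::real"] conjI exI[of _ "1::nat"] allI impI)
  fix n N :: nat
  assume n: "1 \<le> n" and N: "200 * real n ^ 2 \<le> real N \<and> real N \<le> exp (real n / 200)"
  \<comment> \<open>The least \<open>d\<close> with \<open>exp (d / 16) / 2 \<ge> N\<close>; then
    \<open>q\<close> is the largest number of cubes that fits into dimension
    \<open>n\<close>.\<close>
  define d where "d = nat \<lceil>16 * ln (2 * real N)\<rceil>"
  define q where "q = n div (d + 1)"
  define R where "R = real n / (200 * ln (real N))"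
  have "1 \<le> real n ^ 2"
    using n by simp
  then have N200: "200 \<le> real N"
    using N by linarith
  have "exp 1 \<le> real N" "exp 1 \<ge> (2::real)"
    using exp_le N200 exp_ge_add_one_self[of 1] by linarith+
  then have ln1: "1 \<le> ln (real N)"
    using N200 by (subst ln_ge_iff) auto
  have lnn: "200 * ln (real N) \<le> real n"
    using N N200 ln_le_cancel_iff[of "real N" "exp (real n / 200)"] by simp
  have "ln 2 \<le> (1::real)"
    using ln_le_minus_one[of 2] by simp
  moreover have "real d < 16 * ln (2 * real N) + 1"
    unfolding d_def using ln1 N200 by (simp add: ln_mult) linarith
  \<comment> \<open>As \<open>ln 2 \<le> 1\<close>, the left side is at most
    \<open>16 * ln N + 18\<close>, and \<open>ln N \<ge> 1\<close> absorbs the constant.\<close>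
  ultimately have d: "real (d + 1) \<le> 34 * ln (real N)"
    using ln1 N200 by (simp add: ln_mult)
  have R: "1 \<le> R"
    using lnn ln1 by (simp add: R_def)
  have Rq: "R \<le> real q"
  proof -
    \<comment> \<open>The constant 200 exceeds \<open>2 * 34\<close>. The factor 2 yields
      \<open>2 * R \<ge> R + 1\<close>, and the extra 1 pays for rounding down in
      \<open>q\<close>.\<close>
    have "2 * R * real (d + 1) \<le> 2 * R * (34 * ln (real N))"
      using d R by (intro mult_left_mono) auto
    also have "\<dots> \<le> real n"
      using ln1 by (simp add: R_def)
    finally have "R + 1 \<le> real n / real (d + 1)"
      using R mult_right_mono[of "R + 1" "2 * R" "real (d + 1)"] by (simp add: field_simps)
    also have "\<dots> < real q + 1"
      using dividend_less_div_times[of "d + 1" n]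
      by (simp add: q_def field_simps flip: of_nat_mult of_nat_add of_nat_Suc)
    finally show ?thesis
      by simp
  qed
  have q0: "0 < q"
    using R Rq by (cases q) auto
  have qd: "q * (d + 1) \<le> n"
    unfolding q_def by (rule div_times_less_eq_dividend)
  then have qn: "q \<le> n"
    by simp
  have count: "N \<le> card (verticesn P)"
    if "polytopen n P" "P \<subseteq> translate (cube_join n q) \<xi>" "translate (cube_join n q) \<xi> \<subseteq> scalen R P"
    for P \<xi>
  proof -
    have "ln (2 * real N) \<le> real d / 16"
      unfolding d_def by linarith
    then have "exp (ln (2 * real N)) \<le> exp (real d / 16)"
      by simp
    then have "2 * real N \<le> exp (real d / 16)"
      using N200 by simp
    then show ?thesis
      using cube_join_vertex_count[OF that R Rq qd] by linarith
  qed
  show "\<exists>K. convex_body n K \<and>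
        (\<forall>\<xi>\<in>segmentn (barycenter n K) (santalo_point n K).
           \<forall>P. polytopen n P \<and> P \<subseteq> translate K \<xi> \<and>
               translate K \<xi> \<subseteq> scalen (real n / (200 * ln (real N))) P
               \<longrightarrow> card (verticesn P) \<ge> N)"
    using convex_body_cube_join[OF q0 qn] count unfolding R_def by blast
qed simp

end
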